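(* Let $\tau_{\mathsf{min}}^{\mathsf{sh}}$ be the topology on $\mathscr{C}_{\mathbb{Z}}^{\mathbf{0}}$ in which all non-zero elements are isolated points and in which the family of all sets $$U_{(a_1,b_1),\ldots,(a_k,b_k)}^{\uparrow}=\mathscr{C}_{\mathbb{Z}}^{\mathbf{0}}\setminus\left({\uparrow}_{\preccurlyeq}(a_1,b_1)\cup\cdots\cup{\uparrow}_{\preccurlyeq}(a_k,b_k)\right),\qquad k\in\mathbb{N},\ (a_1,b_1),\ldots,(a_k,b_k)\in\mathscr{C}_{\mathbb{Z}},$$ is a base at zero $\mathbf{0}$. Then $\left(\mathscr{C}_{\mathbb{Z}}^{\mathbf{0}},\tau_{\mathsf{min}}^{\mathsf{sh}}\right)$ is a minimal semitopological semigroup with continuous inversion.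
   Context: The extended bicyclic semigroup is the set $\mathscr{C}_{\mathbb{Z}}=\mathbb{Z}\times\mathbb{Z}$ with the operation $(a,b)\cdot(c,d)=(a-b+c,d)$ if $b<c$; $(a,b)\cdot(c,d)=(a,d)$ if $b=c$; $(a,b)\cdot(c,d)=(a,d+b-c)$ if $b>c$. $\mathscr{C}_{\mathbb{Z}}^{\mathbf{0}}=\mathscr{C}_{\mathbb{Z}}\sqcup\{\mathbf{0}\}$ is $\mathscr{C}_{\mathbb{Z}}$ with an adjoined zero $\mathbf{0}$. It is an inverse semigroup with inversion $(a,b)^{-1}=(b,a)$, $\mathbf{0}^{-1}=\mathbf{0}$. Let $\preccurlyeq$ be its natural partial order ($s\preccurlyeq t$ iff $s=et$ for some idempotent $e$); for $(a,b)\in\mathscr{C}_{\mathbb{Z}}$, ${\uparrow}_{\preccurlyeq}(a,b)=\{(x,y)\in\mathscr{C}_{\mathbb{Z}}\colon (a,b)\preccurlyeq(x,y)\}=\{(x,y)\in\mathscr{C}_{\mathbb{Z}}\colon a-b=x-y \text{ and } x\leqslant a\}$. A semitopological semigroup is a topological space with a separately continuous semigroup operation; a topology on a semigroup $S$ is shift-continuous if it makes $S$ a semitopological semigroup. A Hausdorff semitopological semigroup $(S,\tau)$ is minimal if no Hausdorff shift-continuous topology on $S$ is strictly contained in $\tau$. *)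

theory Defs
  imports "HOL-Analysis.Analysis"
begin

definition ext_bicyclic_mult :: "int \<times> int \<Rightarrow> int \<times> int \<Rightarrow> int \<times> int" where
  "ext_bicyclic_mult = (\<lambda>(a, b) (c, d).
     if b < c then (a - b + c, d)
     else if b = c then (a, d)
     else (a, d + b - c))"

text \<open>A semigroup on the type \<open>'a\<close> with an adjoined zero lives on \<open>'a option\<close>;
  \<open>None\<close> is the zero.\<close>

fun adjoin_zero :: "('a \<Rightarrow> 'a \<Rightarrow> 'a) \<Rightarrow> 'a option \<Rightarrow> 'a option \<Rightarrow> 'a option" where
  "adjoin_zero f (Some x) (Some y) = Some (f x y)"
| "adjoin_zero f _ _ = None"

abbreviation ext_bicyclic0_mult ::
  "(int \<times> int) option \<Rightarrow> (int \<times> int) option \<Rightarrow> (int \<times> int) option" where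
  "ext_bicyclic0_mult \<equiv> adjoin_zero ext_bicyclic_mult"

fun ext_bicyclic0_inverse :: "(int \<times> int) option \<Rightarrow> (int \<times> int) option" where
  "ext_bicyclic0_inverse (Some (a, b)) = Some (b, a)"
| "ext_bicyclic0_inverse None = None"

definition natural_le :: "('a \<Rightarrow> 'a \<Rightarrow> 'a) \<Rightarrow> 'a \<Rightarrow> 'a \<Rightarrow> bool" where
  "natural_le f s t \<longleftrightarrow> (\<exists>e. f e e = e \<and> s = f e t)"

definition ext_bicyclic0_up :: "int \<times> int \<Rightarrow> (int \<times> int) option set" where
  "ext_bicyclic0_up p = {Some q | q. natural_le ext_bicyclic0_mult (Some p) (Some q)}"

definition semitopological_semigroup :: "('a \<Rightarrow> 'a \<Rightarrow> 'a) \<Rightarrow> 'a topology \<Rightarrow> bool" where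
  "semitopological_semigroup f T \<longleftrightarrow>
     semigroup f \<and> topspace T = UNIV \<and>
     (\<forall>a. continuous_map T T (\<lambda>x. f a x)) \<and> (\<forall>a. continuous_map T T (\<lambda>x. f x a))"

definition minimal_semitopological_semigroup :: "('a \<Rightarrow> 'a \<Rightarrow> 'a) \<Rightarrow> 'a topology \<Rightarrow> bool" where
  "minimal_semitopological_semigroup f T \<longleftrightarrow>
     semitopological_semigroup f T \<and> Hausdorff_space T \<and>
     \<not> (\<exists>T'. semitopological_semigroup f T' \<and> Hausdorff_space T' \<and>
             {U. openin T' U} \<subset> {U. openin T U})"

definition tau_min_sh_base :: "(int \<times> int) option set set" where
  "tau_min_sh_base = {UNIV - (\<Union>p\<in>F. ext_bicyclic0_up p) | F. finite F \<and> F \<noteq> {}}"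

text \<open>A set is open iff it misses the zero or contains a basic neighbourhood of the zero;
  the lemmas below show that this is the topology with isolated non-zero points and
  the given base at the zero, and that it is the only one.\<close>

definition tau_min_sh :: "(int \<times> int) option topology" where
  "tau_min_sh = topology (\<lambda>A. None \<in> A \<longrightarrow> (\<exists>U\<in>tau_min_sh_base. U \<subseteq> A))"

lemma tau_min_sh_base_Int:
  assumes "U \<in> tau_min_sh_base" "V \<in> tau_min_sh_base"
  shows "U \<inter> V \<in> tau_min_sh_base"
proof -
  obtain F G where F: "finite F" "F \<noteq> {}" "U = UNIV - (\<Union>p\<in>F. ext_bicyclic0_up p)"
    and G: "finite G" "G \<noteq> {}" "V = UNIV - (\<Union>p\<in>G. ext_bicyclic0_up p)"
    using assms unfolding tau_min_sh_base_def by blast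
  have "U \<inter> V = UNIV - (\<Union>p\<in>F \<union> G. ext_bicyclic0_up p)" using F G by blast
  moreover have "finite (F \<union> G)" "F \<union> G \<noteq> {}" using F G by auto
  ultimately show ?thesis unfolding tau_min_sh_base_def by blast
qed

lemma tau_min_sh_base_nonempty: "tau_min_sh_base \<noteq> {}"
proof -
  have "UNIV - (\<Union>p\<in>{(0, 0)}. ext_bicyclic0_up p) \<in> tau_min_sh_base"
    unfolding tau_min_sh_base_def by blast
  then show ?thesis by blast
qed

lemma openin_tau_min_sh:
  "openin tau_min_sh A \<longleftrightarrow> (None \<in> A \<longrightarrow> (\<exists>U\<in>tau_min_sh_base. U \<subseteq> A))"
proof -
  have "istopology (\<lambda>A. None \<in> A \<longrightarrow> (\<exists>U\<in>tau_min_sh_base. U \<subseteq> A))"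
    unfolding istopology_def
  proof (intro conjI allI impI)
    fix S T :: "(int \<times> int) option set"
    assume "None \<in> S \<longrightarrow> (\<exists>U\<in>tau_min_sh_base. U \<subseteq> S)"
      "None \<in> T \<longrightarrow> (\<exists>U\<in>tau_min_sh_base. U \<subseteq> T)" "None \<in> S \<inter> T"
    then obtain U V where "U \<in> tau_min_sh_base" "U \<subseteq> S" "V \<in> tau_min_sh_base" "V \<subseteq> T"
      by blast
    then show "\<exists>U\<in>tau_min_sh_base. U \<subseteq> S \<inter> T"
      by (meson tau_min_sh_base_Int Int_mono)
  next
    fix K :: "(int \<times> int) option set set"
    assume K: "\<forall>S\<in>K. None \<in> S \<longrightarrow> (\<exists>U\<in>tau_min_sh_base. U \<subseteq> S)" and "None \<in> \<Union>K"
    then obtain S where "S \<in> K" "None \<in> S" by blast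
    then show "\<exists>U\<in>tau_min_sh_base. U \<subseteq> \<Union>K" using K by (meson Union_upper order_trans)
  qed
  then show ?thesis unfolding tau_min_sh_def by (simp add: topology_inverse')
qed

lemma topspace_tau_min_sh [simp]: "topspace tau_min_sh = UNIV"
proof -
  have "openin tau_min_sh UNIV"
    using tau_min_sh_base_nonempty by (auto simp: openin_tau_min_sh)
  then have "UNIV \<subseteq> topspace tau_min_sh" by (rule openin_subset)
  then show ?thesis by (rule top.extremum_uniqueI)
qed

lemma None_in_tau_min_sh_base: "U \<in> tau_min_sh_base \<Longrightarrow> None \<in> U"
  by (auto simp: tau_min_sh_base_def ext_bicyclic0_up_def)

lemma tau_min_sh_unique:
  "T = tau_min_sh \<longleftrightarrow>
     topspace T = UNIV \<and> (\<forall>p. openin T {Some p}) \<and>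
     (\<forall>U\<in>tau_min_sh_base. openin T U \<and> None \<in> U) \<and>
     (\<forall>A. openin T A \<and> None \<in> A \<longrightarrow> (\<exists>U\<in>tau_min_sh_base. U \<subseteq> A))"
  (is "_ \<longleftrightarrow> ?R")
proof
  assume "T = tau_min_sh"
  then show ?R by (auto simp: openin_tau_min_sh None_in_tau_min_sh_base)
next
  assume R: ?R
  have "openin T A \<longleftrightarrow> openin tau_min_sh A" for A
  proof
    assume "openin T A"
    then show "openin tau_min_sh A" using R by (simp add: openin_tau_min_sh)
  next
    assume A: "openin tau_min_sh A"
    show "openin T A"
    proof (subst openin_subopen, intro ballI)
      fix x assume x: "x \<in> A"
      show "\<exists>V. openin T V \<and> x \<in> V \<and> V \<subseteq> A"
      proof (cases x)
        case None
        then obtain U where "U \<in> tau_min_sh_base" "U \<subseteq> A"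
          using A x unfolding openin_tau_min_sh by blast
        moreover have "openin T U" "None \<in> U" using R \<open>U \<in> tau_min_sh_base\<close> by simp_all
        ultimately show ?thesis using None by (intro exI[of _ U]) simp
      next
        case (Some p)
        moreover have "openin T {Some p}" using R by blast
        ultimately show ?thesis using x by (intro exI[of _ "{Some p}"]) simp
      qed
    qed
  qed
  then show "T = tau_min_sh" by (simp add: topology_eq)
qed

lemma ext_bicyclic0_up_eq:
  "ext_bicyclic0_up (a, b) = {Some (x, y) | x y. a - b = x - y \<and> x \<le> a}"
proof -
  have "natural_le ext_bicyclic0_mult (Some (a, b)) (Some (x, y)) \<longleftrightarrow> a - b = x - y \<and> x \<le> a"
    for x y
  proof
    assume "natural_le ext_bicyclic0_mult (Some (a, b)) (Some (x, y))"
    then obtain e where e: "ext_bicyclic0_mult e e = e"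
      "Some (a, b) = ext_bicyclic0_mult e (Some (x, y))"
      unfolding natural_le_def by blast
    then obtain c d where "e = Some (c, d)" by (cases e) auto
    with e show "a - b = x - y \<and> x \<le> a"
      by (auto simp: ext_bicyclic_mult_def split: if_splits)
  next
    assume "a - b = x - y \<and> x \<le> a"
    then show "natural_le ext_bicyclic0_mult (Some (a, b)) (Some (x, y))"
      unfolding natural_le_def
      by (intro exI[of _ "Some (a, a)"]) (auto simp: ext_bicyclic_mult_def)
  qed
  then show ?thesis unfolding ext_bicyclic0_up_def by auto
qed

lemma ext_bicyclic0_inverse_unique:
  "ext_bicyclic0_mult (ext_bicyclic0_mult s t) s = s \<and>
   ext_bicyclic0_mult (ext_bicyclic0_mult t s) t = t \<longleftrightarrow> t = ext_bicyclic0_inverse s"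
  by (cases s; cases t) (auto simp: ext_bicyclic_mult_def split: if_splits)

end

theory Submission
  imports Defs
begin

text \<open>The set \<open>up (a, b)\<close> is the solution set of \<open>(a, a) x = (a, b)\<close>, so it is closed in every
  Hausdorff shift-continuous topology \<open>T\<close>; hence the basic neighbourhoods of the zero are open in
  \<open>T\<close>. If moreover \<open>T\<close> is coarser than \<open>tau_min_sh\<close>, then a nonzero \<open>(a, b)\<close> is separated from
  the zero by a neighbourhood inside finitely many sets \<open>up f\<close>, and those which do not contain
  \<open>(a, b)\<close> can be removed, so the neighbourhood lies on the diagonal of \<open>(a, b)\<close>. Removing the closed
  sets \<open>up (a - 1, b - 1)\<close> and \<open>{x. (a + 1, a + 1) x = x}\<close>, which contain the points of the diagonal
  on either side of \<open>(a, b)\<close>, isolates \<open>(a, b)\<close>. Thus \<open>T\<close> equals \<open>tau_min_sh\<close>. Shifts and inversion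
  are continuous because the preimage of each \<open>up p\<close> is covered by at most two sets of this form.\<close>

lemma semigroup_ext_bicyclic0: "semigroup ext_bicyclic0_mult"
proof
  show "ext_bicyclic0_mult (ext_bicyclic0_mult x y) z
      = ext_bicyclic0_mult x (ext_bicyclic0_mult y z)" for x y z
    by (cases x; cases y; cases z) (auto simp: ext_bicyclic_mult_def)
qed

lemma Some_in_ext_bicyclic0_up_iff:
  "Some (x, y) \<in> ext_bicyclic0_up (a, b) \<longleftrightarrow> a - b = x - y \<and> x \<le> a"
  by (auto simp: ext_bicyclic0_up_eq)

lemma None_notin_ext_bicyclic0_up: "None \<notin> ext_bicyclic0_up p"
  by (simp add: ext_bicyclic0_up_def)

lemma Some_in_ext_bicyclic0_up_self: "Some p \<in> ext_bicyclic0_up p"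
  by (cases p) (simp add: Some_in_ext_bicyclic0_up_iff)

text \<open>Left multiplication by the idempotent \<open>(a, a)\<close> fixes \<open>(x, y)\<close>
  if \<open>a < x\<close>; otherwise it moves \<open>(x, y)\<close> along its diagonal to the point
  with first coordinate \<open>a\<close>.\<close>

lemma ext_bicyclic0_up_eq_translate:
  "ext_bicyclic0_up (a, b) = {x. ext_bicyclic0_mult (Some (a, a)) x = Some (a, b)}"
proof -
  have "x \<in> ext_bicyclic0_up (a, b) \<longleftrightarrow> ext_bicyclic0_mult (Some (a, a)) x = Some (a, b)" for x
    by (cases x) (auto simp: None_notin_ext_bicyclic0_up Some_in_ext_bicyclic0_up_iff
        ext_bicyclic_mult_def split: if_splits)
  then show ?thesis by blast
qed

text \<open>Sets that miss the zero are open, so only preimages that contain the zero need a check,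
  and for these covering each preimage of an \<open>up\<close> set by finitely many such sets
  suffices.\<close>

lemma continuous_map_tau_min_shI:
  assumes None: "f None = None"
    and up: "\<And>p. \<exists>G. finite G \<and> f -` ext_bicyclic0_up p \<subseteq> (\<Union>q\<in>G. ext_bicyclic0_up q)"
  shows "continuous_map tau_min_sh tau_min_sh f"
proof -
  obtain G where G: "finite (G p)" "f -` ext_bicyclic0_up p \<subseteq> (\<Union>q\<in>G p. ext_bicyclic0_up q)"
    for p
    using up by metis
  have "openin tau_min_sh (f -` A)" if A: "openin tau_min_sh A" for A
    unfolding openin_tau_min_sh
  proof
    assume "None \<in> f -` A"
    then have "None \<in> A" using None by simp
    then obtain F where F: "finite F" "F \<noteq> {}" "UNIV - (\<Union>p\<in>F. ext_bicyclic0_up p) \<subseteq> A"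
      using A unfolding openin_tau_min_sh tau_min_sh_base_def by blast
    \<comment> \<open>The sets \<open>G p\<close> may all be empty; including \<open>F\<close> keeps
      the index set of the basic neighbourhood nonempty.\<close>
    let ?H = "F \<union> (\<Union>p\<in>F. G p)"
    have "UNIV - (\<Union>p\<in>?H. ext_bicyclic0_up p) \<in> tau_min_sh_base"
      using F(1,2) G(1) unfolding tau_min_sh_base_def by blast
    moreover have "UNIV - (\<Union>p\<in>?H. ext_bicyclic0_up p) \<subseteq> f -` A"
    proof
      fix x assume x: "x \<in> UNIV - (\<Union>p\<in>?H. ext_bicyclic0_up p)"
      have "f x \<notin> ext_bicyclic0_up p" if "p \<in> F" for p
      proof -
        have "x \<notin> (\<Union>q\<in>G p. ext_bicyclic0_up q)" using x that by simp
        then show ?thesis using G(2)[of p] by (meson subsetD vimageI2)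
      qed
      then show "x \<in> f -` A" using F(3) by auto
    qed
    ultimately show "\<exists>U\<in>tau_min_sh_base. U \<subseteq> f -` A" by blast
  qed
  then show ?thesis by (simp add: continuous_map_def vimage_def)
qed

lemma continuous_map_tau_min_sh_left_mult:
  "continuous_map tau_min_sh tau_min_sh (ext_bicyclic0_mult s)"
proof (rule continuous_map_tau_min_shI)
  show "ext_bicyclic0_mult s None = None" by (cases s) simp_all
  fix p :: "int \<times> int"
  obtain c d where p: "p = (c, d)" by (cases p)
  show "\<exists>G. finite G \<and> ext_bicyclic0_mult s -` ext_bicyclic0_up p \<subseteq> (\<Union>q\<in>G. ext_bicyclic0_up q)"
  proof (cases s)
    case None
    then show ?thesis by (intro exI[of _ "{}"]) (auto simp: None_notin_ext_bicyclic0_up)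
  next
    case (Some t)
    obtain i j where t: "t = (i, j)" by (cases t)
    \<comment> \<open>The first set covers the \<open>x\<close> whose first coordinate is below
      \<open>j\<close>, the second set the others, where the product has the second coordinate of
      \<open>x\<close>. Both sets lie on one diagonal.\<close>
    have "x \<in> ext_bicyclic0_up (j, d - c + i) \<union> ext_bicyclic0_up (c - i + j, d)"
      if "ext_bicyclic0_mult s x \<in> ext_bicyclic0_up p" for x
      using that unfolding Some t p
      by (cases x) (auto simp: None_notin_ext_bicyclic0_up Some_in_ext_bicyclic0_up_iff
          ext_bicyclic_mult_def split: if_splits)
    then show ?thesis by (intro exI[of _ "{(j, d - c + i), (c - i + j, d)}"]) auto
  qed
qed

lemma continuous_map_tau_min_sh_right_mult:
  "continuous_map tau_min_sh tau_min_sh (\<lambda>x. ext_bicyclic0_mult x s)"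
proof (rule continuous_map_tau_min_shI)
  show "ext_bicyclic0_mult None s = None" by simp
  fix p :: "int \<times> int"
  obtain c d where p: "p = (c, d)" by (cases p)
  show "\<exists>G. finite G \<and> (\<lambda>x. ext_bicyclic0_mult x s) -` ext_bicyclic0_up p
      \<subseteq> (\<Union>q\<in>G. ext_bicyclic0_up q)"
  proof (cases s)
    case None
    then show ?thesis by (intro exI[of _ "{}"]) (auto simp: None_notin_ext_bicyclic0_up)
  next
    case (Some t)
    obtain i j where t: "t = (i, j)" by (cases t)
    \<comment> \<open>Dually, the cases are whether the second coordinate of \<open>x\<close> is
      below \<open>i\<close> or not.\<close>
    have "x \<in> ext_bicyclic0_up (c - d + j, i) \<union> ext_bicyclic0_up (c, d + i - j)"
      if "ext_bicyclic0_mult x s \<in> ext_bicyclic0_up p" for x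
      using that unfolding Some t p
      by (cases x) (auto simp: None_notin_ext_bicyclic0_up Some_in_ext_bicyclic0_up_iff
          ext_bicyclic_mult_def split: if_splits)
    then show ?thesis by (intro exI[of _ "{(c - d + j, i), (c, d + i - j)}"]) auto
  qed
qed

lemma continuous_map_tau_min_sh_inverse:
  "continuous_map tau_min_sh tau_min_sh ext_bicyclic0_inverse"
proof (rule continuous_map_tau_min_shI)
  fix p :: "int \<times> int"
  obtain c d where p: "p = (c, d)" by (cases p)
  have "x \<in> ext_bicyclic0_up (d, c)" if "ext_bicyclic0_inverse x \<in> ext_bicyclic0_up p" for x
    using that unfolding p
    by (cases x) (auto simp: None_notin_ext_bicyclic0_up Some_in_ext_bicyclic0_up_iff)
  then show "\<exists>G. finite G \<and> ext_bicyclic0_inverse -` ext_bicyclic0_up p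
      \<subseteq> (\<Union>q\<in>G. ext_bicyclic0_up q)"
    by (intro exI[of _ "{(d, c)}"]) auto
qed simp

lemma semitopological_semigroup_tau_min_sh:
  "semitopological_semigroup ext_bicyclic0_mult tau_min_sh"
  by (simp add: semitopological_semigroup_def semigroup_ext_bicyclic0
      continuous_map_tau_min_sh_left_mult continuous_map_tau_min_sh_right_mult)

lemma Hausdorff_space_tau_min_sh: "Hausdorff_space tau_min_sh"
proof -
  have isolated: "openin tau_min_sh {Some p}" for p by (simp add: openin_tau_min_sh)
  \<comment> \<open>One of two distinct points is nonzero, so by symmetry it is enough to separate
    \<open>Some p\<close> from any other point.\<close>
  have sep: "\<exists>U V. openin tau_min_sh U \<and> openin tau_min_sh V \<and> Some p \<in> U \<and> y \<in> V \<and> disjnt U V"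
    if "y \<noteq> Some p" for p y
  proof (cases y)
    case None
    have "UNIV - ext_bicyclic0_up p \<in> tau_min_sh_base"
      unfolding tau_min_sh_base_def by (intro CollectI exI[of _ "{p}"]) simp
    then have "openin tau_min_sh (UNIV - ext_bicyclic0_up p)"
      unfolding openin_tau_min_sh by blast
    moreover have "disjnt {Some p} (UNIV - ext_bicyclic0_up p)"
      by (simp add: Some_in_ext_bicyclic0_up_self)
    ultimately show ?thesis
      using isolated None None_notin_ext_bicyclic0_up by blast
  next
    case (Some q)
    moreover have "disjnt {Some p} {Some q}" using that Some by simp
    ultimately show ?thesis using isolated by blast
  qed
  show ?thesis
    unfolding Hausdorff_space_def
  proof (intro allI impI, elim conjE)
    fix x y :: "(int \<times> int) option"
    assume "x \<noteq> y"
    then show "\<exists>U V. openin tau_min_sh U \<and> openin tau_min_sh V \<and> x \<in> U \<and> y \<in> V \<and> disjnt U V"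
      using sep[of y] sep[of x] by (cases x; cases y) (metis disjnt_sym)+
  qed
qed

locale Hausdorff_shift_continuous =
  fixes T :: "(int \<times> int) option topology"
  assumes semitopological: "semitopological_semigroup ext_bicyclic0_mult T"
    and Hausdorff: "Hausdorff_space T"
begin

lemma topspace_UNIV: "topspace T = UNIV"
  using semitopological by (simp add: semitopological_semigroup_def)

lemma continuous_left_mult: "continuous_map T T (ext_bicyclic0_mult s)"
  using semitopological unfolding semitopological_semigroup_def by blast

lemma closedin_up: "closedin T (ext_bicyclic0_up p)"
proof -
  obtain a b where p: "p = (a, b)" by (cases p)
  have "closedin T {x \<in> topspace T. ext_bicyclic0_mult (Some (a, a)) x = Some (a, b)}"
    by (intro closedin_continuous_maps_eq[OF Hausdorff] continuous_left_mult)
      (simp add: topspace_UNIV)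
  then show ?thesis by (simp add: p ext_bicyclic0_up_eq_translate topspace_UNIV)
qed

text \<open>This is the equalizer of a continuous shift and the identity in a Hausdorff
  space.\<close>

lemma closedin_left_fixed: "closedin T {x. ext_bicyclic0_mult s x = x}"
  using closedin_continuous_maps_eq[OF Hausdorff continuous_left_mult[of s] continuous_map_id]
  by (simp add: topspace_UNIV)

lemma openin_tau_min_sh_base:
  assumes "U \<in> tau_min_sh_base"
  shows "openin T U"
proof -
  obtain F where F: "finite F" "U = UNIV - (\<Union>p\<in>F. ext_bicyclic0_up p)"
    using assms unfolding tau_min_sh_base_def by blast
  have "closedin T (\<Union>p\<in>F. ext_bicyclic0_up p)"
    using F(1) closedin_up by (intro closedin_Union) auto
  then show ?thesis using F(2) topspace_UNIV by (metis closedin_def)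
qed

lemma openin_Some:
  assumes coarser: "\<And>U. openin T U \<Longrightarrow> openin tau_min_sh U"
  shows "openin T {Some p}"
proof -
  obtain a b where p: "p = (a, b)" by (cases p)
  obtain W V where W: "openin T W" "Some p \<in> W" and V: "openin T V" "None \<in> V"
    and "disjnt W V"
    using Hausdorff unfolding Hausdorff_space_def topspace_UNIV by (metis UNIV_I option.distinct(1))
  obtain F where F: "finite F" "UNIV - (\<Union>q\<in>F. ext_bicyclic0_up q) \<subseteq> V"
    using coarser[OF V(1)] V(2) unfolding openin_tau_min_sh tau_min_sh_base_def by blast
  have W_up: "W \<subseteq> (\<Union>q\<in>F. ext_bicyclic0_up q)"
    using F(2) \<open>disjnt W V\<close> unfolding disjnt_def by blast
  define F' where "F' = {q \<in> F. Some p \<notin> ext_bicyclic0_up q}"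
  define C where "C = (\<Union>q\<in>F'. ext_bicyclic0_up q) \<union> ext_bicyclic0_up (a - 1, b - 1)
    \<union> {x. ext_bicyclic0_mult (Some (a + 1, a + 1)) x = x}"
  have "closedin T (\<Union>q\<in>F'. ext_bicyclic0_up q)"
    using F(1) closedin_up by (intro closedin_Union) (auto simp: F'_def)
  then have "closedin T C"
    unfolding C_def by (intro closedin_Un closedin_up closedin_left_fixed)
  then have "openin T (W - C)" using W(1) by (intro openin_diff)
  moreover have "W - C = {Some p}"
  proof
    \<comment> \<open>The point \<open>(a, b)\<close> is not fixed by \<open>(a + 1, a + 1)\<close>,
      which sends it to \<open>(a + 1, b + 1)\<close>.\<close>
    have "Some p \<notin> C"
      by (auto simp: C_def F'_def p Some_in_ext_bicyclic0_up_iff ext_bicyclic_mult_def)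
    then show "{Some p} \<subseteq> W - C" using W(2) by simp
    show "W - C \<subseteq> {Some p}"
    proof
      fix x assume x: "x \<in> W - C"
      then obtain q where q: "q \<in> F" "x \<in> ext_bicyclic0_up q" using W_up by blast
      obtain c d where cd: "q = (c, d)" by (cases q)
      obtain k l where kl: "x = Some (k, l)"
        using q(2) None_notin_ext_bicyclic0_up by (cases x) auto
      \<comment> \<open>Otherwise \<open>q\<close> would belong to \<open>F'\<close> and
        \<open>x\<close> to \<open>C\<close>.\<close>
      have "Some p \<in> ext_bicyclic0_up q"
        using x q unfolding C_def F'_def by blast
      then have "a - b = k - l" using q(2) by (simp add: p cd kl Some_in_ext_bicyclic0_up_iff)
      moreover have "\<not> k \<le> a - 1"
        using x calculation by (auto simp: C_def kl Some_in_ext_bicyclic0_up_iff)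
      moreover have "\<not> a + 1 \<le> k" using x by (auto simp: C_def kl ext_bicyclic_mult_def split: if_splits)
      ultimately show "x \<in> {Some p}" by (simp add: p kl)
    qed
  qed
  ultimately show ?thesis by simp
qed

lemma eq_tau_min_sh:
  assumes "\<And>U. openin T U \<Longrightarrow> openin tau_min_sh U"
  shows "T = tau_min_sh"
proof (subst tau_min_sh_unique, intro conjI allI ballI impI)
  show "\<exists>U\<in>tau_min_sh_base. U \<subseteq> A" if "openin T A \<and> None \<in> A" for A
    using assms[of A] that by (simp add: openin_tau_min_sh)
qed (simp_all add: assms topspace_UNIV openin_Some openin_tau_min_sh_base None_in_tau_min_sh_base)

end

theorem proposition4:
  shows "minimal_semitopological_semigroup ext_bicyclic0_mult tau_min_sh \<and>
         continuous_map tau_min_sh tau_min_sh ext_bicyclic0_inverse"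
proof -
  \<comment> \<open>Equality contradicts the strict inclusion, so no such \<open>T\<close>
    exists.\<close>
  have "T = tau_min_sh"
    if "semitopological_semigroup ext_bicyclic0_mult T" "Hausdorff_space T"
      "{U. openin T U} \<subset> {U. openin tau_min_sh U}" for T
    using that by (intro Hausdorff_shift_continuous.eq_tau_min_sh)
      (auto simp: Hausdorff_shift_continuous_def)
  then show ?thesis
    unfolding minimal_semitopological_semigroup_def
    using semitopological_semigroup_tau_min_sh Hausdorff_space_tau_min_sh
      continuous_map_tau_min_sh_inverse by blast
qed

end
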